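(* Let $n\geq 2$ and let $f\in L^1(\mathbb{S}^{n-1})$ be real-valued. Then the cosine transform of $f$, $$Tf(x)=\int_{\mathbb{S}^{n-1}}|\langle x,\xi\rangle|\,f(\xi)\,d\xi,\qquad x\in\mathbb{R}^n,$$ is continuously differentiable in $\mathbb{R}^n\setminus\{0\}$.
   Context: $\mathbb{S}^{n-1}$ is the Euclidean unit sphere in $\mathbb{R}^n$, $\langle\cdot,\cdot\rangle$ the standard scalar product, and $d\xi$ the spherical Lebesgue measure on $\mathbb{S}^{n-1}$; $L^1(\mathbb{S}^{n-1})$ is taken with respect to this measure. *)

theory Defs
  imports "HOL-Analysis.Analysis"
begin

(* The spherical measure is obtained from Lebesgue measure through polar coordinates:
   sigma(A) = n * vol {t xi | 0 < t <= 1, xi in A}, see emeasure_sphere_borel below.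
   It is the (unnormalised) surface measure. Its space is the unit sphere, so that integrals
   and integrability do not depend on the values of the integrand elsewhere. *)

definition sphere_borel :: "'a::euclidean_space measure" where
  "sphere_borel =
     scale_measure (of_nat DIM('a))
       (distr (restrict_space lborel (cball 0 1 - {0})) (restrict_space borel (sphere 0 1))
          (\<lambda>x. x /\<^sub>R norm x))"

(* completed, so that all Lebesgue (not only Borel) measurable functions are admitted *)
definition sphere_lebesgue :: "'a::euclidean_space measure" where
  "sphere_lebesgue = completion sphere_borel"

definition cosine_transform :: "('a::euclidean_space \<Rightarrow> real) \<Rightarrow> 'a \<Rightarrow> real" where
  "cosine_transform f x = (\<integral>\<xi>. \<bar>x \<bullet> \<xi>\<bar> * f \<xi> \<partial>sphere_lebesgue)"

definition continuously_differentiable_on ::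
    "('a::real_normed_vector \<Rightarrow> 'b::real_normed_vector) \<Rightarrow> 'a set \<Rightarrow> bool" where
  "continuously_differentiable_on f S \<longleftrightarrow>
     open S \<and>
     (\<exists>f' :: 'a \<Rightarrow> 'a \<Rightarrow>\<^sub>L 'b.
        (\<forall>x\<in>S. (f has_derivative blinfun_apply (f' x)) (at x)) \<and> continuous_on S f')"

lemma space_sphere_lebesgue: "space (sphere_lebesgue :: 'a::euclidean_space measure) = sphere 0 1"
  by (simp add: sphere_lebesgue_def sphere_borel_def space_scale_measure space_restrict_space)

lemma measurable_radial_projection:
  "(\<lambda>x::'a::euclidean_space. x /\<^sub>R norm x)
     \<in> restrict_space lborel (cball 0 1 - {0}) \<rightarrow>\<^sub>M restrict_space borel (sphere 0 1)"
  by (intro measurable_restrict_space2 measurable_restrict_space1)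
     (auto simp: space_restrict_space)

lemma emeasure_sphere_borel:
  fixes A :: "'a::euclidean_space set"
  assumes "A \<in> sets borel" "A \<subseteq> sphere 0 1"
  shows "emeasure sphere_borel A =
           of_nat DIM('a) * emeasure lborel {t *\<^sub>R \<xi> | t \<xi>. 0 < t \<and> t \<le> 1 \<and> \<xi> \<in> A}"
proof -
  have A: "A \<in> sets (restrict_space borel (sphere 0 1))"
    using assms by (auto simp: sets_restrict_space_iff)
  let ?B = "cball (0::'a) 1 - {0}"
  have eq: "(\<lambda>x. x /\<^sub>R norm x) -` A \<inter> ?B = {t *\<^sub>R \<xi> | t \<xi>. 0 < t \<and> t \<le> 1 \<and> \<xi> \<in> A}"
  proof (intro equalityI subsetI)
    fix x assume "x \<in> (\<lambda>x. x /\<^sub>R norm x) -` A \<inter> ?B"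
    then show "x \<in> {t *\<^sub>R \<xi> | t \<xi>. 0 < t \<and> t \<le> 1 \<and> \<xi> \<in> A}"
      by (auto intro!: exI[of _ "norm x"] exI[of _ "x /\<^sub>R norm x"])
  next
    fix x assume "x \<in> {t *\<^sub>R \<xi> | t \<xi>. 0 < t \<and> t \<le> 1 \<and> \<xi> \<in> A}"
    then obtain t \<xi> where t: "x = t *\<^sub>R \<xi>" "0 < t" "t \<le> 1" "\<xi> \<in> A" by auto
    with assms(2) have "norm \<xi> = 1" by auto
    with t show "x \<in> (\<lambda>x. x /\<^sub>R norm x) -` A \<inter> ?B" by auto
  qed
  have "emeasure sphere_borel A = of_nat DIM('a) *
          emeasure (restrict_space lborel ?B) ((\<lambda>x. x /\<^sub>R norm x) -` A \<inter> ?B)"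
    by (simp add: sphere_borel_def emeasure_distr[OF measurable_radial_projection A]
        space_restrict_space)
  also have "emeasure (restrict_space lborel ?B) ((\<lambda>x. x /\<^sub>R norm x) -` A \<inter> ?B) =
      emeasure lborel ((\<lambda>x. x /\<^sub>R norm x) -` A \<inter> ?B)"
    by (rule emeasure_restrict_space) auto
  finally show ?thesis unfolding eq .
qed

end

theory Submission
  imports Defs
begin

text \<open>Differentiate under the integral sign. For \<open>x \<noteq> 0\<close> the great subsphere orthogonal to \<open>x\<close> is a
  null set, and off it \<open>y \<mapsto> \<bar>y \<bullet> \<xi>\<bar>\<close> is linear near \<open>x\<close> with gradient \<open>sgn (x \<bullet> \<xi>) \<xi>\<close>. Since all
  difference quotients are bounded, dominated convergence gives both the derivative and the
  continuity of the gradient \<open>\<integral> f(\<xi>) sgn (x \<bullet> \<xi>) \<xi> d\<xi>\<close>.\<close>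

text \<open>Dominated convergence is a statement about sequences; first countability reduces the
  limit at \<open>x\<close> to it. The null set in the bound may depend on \<open>y\<close>, since a
  sequence meets only countably many of them.\<close>

lemma tendsto_integral_at:
  fixes g :: "'b::first_countable_topology \<Rightarrow> 'a \<Rightarrow> 'c::{banach, second_countable_topology}"
  assumes "\<And>y. g y \<in> borel_measurable M"
    and "h \<in> borel_measurable M"
    and "integrable M w"
    and "AE \<xi> in M. ((\<lambda>y. g y \<xi>) \<longlongrightarrow> h \<xi>) (at x)"
    and "\<And>y. AE \<xi> in M. norm (g y \<xi>) \<le> w \<xi>"
  shows "((\<lambda>y. \<integral>\<xi>. g y \<xi> \<partial>M) \<longlongrightarrow> (\<integral>\<xi>. h \<xi> \<partial>M)) (at x)"
  unfolding tendsto_at_iff_sequentially comp_def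
proof (intro allI impI)
  fix X :: "nat \<Rightarrow> 'b"
  assume X: "\<forall>i. X i \<in> UNIV - {x}" "X \<longlonglongrightarrow> x"
  have "AE \<xi> in M. (\<lambda>i. g (X i) \<xi>) \<longlonglongrightarrow> h \<xi>"
    using assms(4) by eventually_elim (use X in \<open>auto simp: tendsto_at_iff_sequentially comp_def\<close>)
  then show "(\<lambda>i. \<integral>\<xi>. g (X i) \<xi> \<partial>M) \<longlonglongrightarrow> (\<integral>\<xi>. h \<xi> \<partial>M)"
    by (intro integral_dominated_convergence[where w = w] assms)
qed

lemma eventually_sgn_inner_eq:
  fixes x \<xi> :: "'a::real_inner"
  assumes "x \<bullet> \<xi> \<noteq> 0"
  shows "\<forall>\<^sub>F y in at x. sgn (y \<bullet> \<xi>) = sgn (x \<bullet> \<xi>)"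
proof -
  have lim: "((\<lambda>y. y \<bullet> \<xi>) \<longlongrightarrow> x \<bullet> \<xi>) (at x)"
    by (intro tendsto_intros)
  show ?thesis
  proof (cases "x \<bullet> \<xi> > 0")
    case True
    from order_tendstoD(1)[OF lim this] True show ?thesis
      by (auto elim: eventually_mono)
  next
    case False
    with assms have neg: "x \<bullet> \<xi> < 0" by simp
    from order_tendstoD(2)[OF lim this] neg show ?thesis
      by (auto elim: eventually_mono)
  qed
qed

text \<open>The cone over the great subsphere lies in the hyperplane orthogonal to \<open>x\<close>,
  which has volume zero because \<open>x\<close> is nonzero. The polar coordinate formula carries
  this over to the sphere.\<close>

lemma AE_sphere_lebesgue_inner_nonzero:
  fixes x :: "'a::euclidean_space"
  assumes "x \<noteq> 0"
  shows "AE \<xi> in sphere_lebesgue. x \<bullet> \<xi> \<noteq> 0"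
proof -
  let ?A = "{\<xi> \<in> sphere 0 1. x \<bullet> \<xi> = 0}"
  have "{\<xi>. x \<bullet> \<xi> = 0} \<in> sets (borel :: 'a measure)"
    by measurable
  then have borel: "?A \<in> sets borel"
    using sets.Int[of "sphere 0 1" borel "{\<xi>. x \<bullet> \<xi> = 0}"] by (simp add: Int_def)
  have hyp: "{y. x \<bullet> y = 0} \<in> null_sets lebesgue"
    using negligible_hyperplane[of x 0] assms by (simp add: negligible_iff_null_sets)
  \<comment> \<open>The hyperplane is a Borel set, so being null for the completed measure makes it
    null for \<open>lborel\<close>.\<close>
  then have "{y. x \<bullet> y = 0} \<in> null_sets lborel"
    by (auto simp: null_sets_def)
  have "emeasure lborel {t *\<^sub>R \<xi> |t \<xi>. 0 < t \<and> t \<le> 1 \<and> \<xi> \<in> ?A}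
      \<le> emeasure lborel {y. x \<bullet> y = 0}"
    by (rule emeasure_mono) auto
  also have "\<dots> = 0"
    using \<open>_ \<in> null_sets lborel\<close> by auto
  finally have "emeasure sphere_borel ?A = 0"
    using borel by (subst emeasure_sphere_borel) auto
  moreover have "?A \<in> sets sphere_borel"
    using borel by (auto simp: sphere_borel_def sets_restrict_space_iff)
  ultimately have "?A \<in> null_sets sphere_borel"
    by auto
  then have "AE \<xi> in sphere_borel. \<xi> \<notin> ?A"
    by (rule AE_not_in)
  then have "AE \<xi> in sphere_lebesgue. \<xi> \<notin> ?A"
    unfolding sphere_lebesgue_def by (rule AE_completion)
  then show ?thesis
    by (rule AE_mp) (auto simp: space_sphere_lebesgue)
qed

lemma borel_measurable_sphere_lebesgue:
  fixes g :: "'a::euclidean_space \<Rightarrow> 'b::topological_space"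
  assumes "g \<in> borel_measurable borel"
  shows "g \<in> borel_measurable sphere_lebesgue"
proof -
  have "g \<in> borel_measurable (restrict_space borel (sphere 0 1))"
    using assms by (rule measurable_restrict_space1)
  then have "g \<in> borel_measurable sphere_borel"
    by (simp add: sphere_borel_def measurable_def space_scale_measure)
  then show ?thesis
    unfolding sphere_lebesgue_def by (rule measurable_completion)
qed

lemma AE_sphere_lebesgueI:
  assumes "\<And>\<xi>::'a::euclidean_space. norm \<xi> = 1 \<Longrightarrow> P \<xi>"
  shows "AE \<xi> in sphere_lebesgue. P \<xi>"
  using assms by (intro AE_I2) (simp add: space_sphere_lebesgue)

text \<open>The gradient is kept as a vector, so that limits are taken in \<open>'a\<close>; it
  becomes a bounded functional only in the theorem.\<close>

definition cosine_gradient :: "('a::euclidean_space \<Rightarrow> real) \<Rightarrow> 'a \<Rightarrow> 'a" where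
  "cosine_gradient f x = (\<integral>\<xi>. (sgn (x \<bullet> \<xi>) * f \<xi>) *\<^sub>R \<xi> \<partial>sphere_lebesgue)"

context
  fixes f :: "'a::euclidean_space \<Rightarrow> real"
  assumes f: "integrable sphere_lebesgue f"
begin

lemma integrable_cosine_transform:
  "integrable sphere_lebesgue (\<lambda>\<xi>. \<bar>x \<bullet> \<xi>\<bar> * f \<xi>)"
proof (rule Bochner_Integration.integrable_bound)
  show "integrable sphere_lebesgue (\<lambda>\<xi>. norm x * f \<xi>)"
    using f by simp
  show "(\<lambda>\<xi>. \<bar>x \<bullet> \<xi>\<bar> * f \<xi>) \<in> borel_measurable sphere_lebesgue"
    by (intro borel_measurable_times borel_measurable_sphere_lebesgue
        borel_measurable_integrable[OF f]) measurable
  show "AE \<xi> in sphere_lebesgue. norm (\<bar>x \<bullet> \<xi>\<bar> * f \<xi>) \<le> norm (norm x * f \<xi>)"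
  proof (rule AE_sphere_lebesgueI)
    fix \<xi> :: 'a
    assume "norm \<xi> = 1"
    then have "\<bar>x \<bullet> \<xi>\<bar> \<le> norm x"
      using Cauchy_Schwarz_ineq2[of x \<xi>] by simp
    then show "norm (\<bar>x \<bullet> \<xi>\<bar> * f \<xi>) \<le> norm (norm x * f \<xi>)"
      by (simp add: abs_mult mult_right_mono)
  qed
qed

lemma measurable_cosine_gradient:
  "(\<lambda>\<xi>. (sgn (x \<bullet> \<xi>) * f \<xi>) *\<^sub>R \<xi>) \<in> borel_measurable sphere_lebesgue"
  by (intro borel_measurable_scaleR borel_measurable_times borel_measurable_sphere_lebesgue
      borel_measurable_integrable[OF f]) measurable

text \<open>The dominating function does not depend on \<open>x\<close>, so it serves both
  integrability and continuity of the gradient.\<close>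

lemma cosine_gradient_bound:
  "AE \<xi> in sphere_lebesgue. norm ((sgn (x \<bullet> \<xi>) * f \<xi>) *\<^sub>R \<xi>) \<le> \<bar>f \<xi>\<bar>"
  by (rule AE_sphere_lebesgueI) (simp add: abs_mult sgn_if)

lemma integrable_cosine_gradient:
  "integrable sphere_lebesgue (\<lambda>\<xi>. (sgn (x \<bullet> \<xi>) * f \<xi>) *\<^sub>R \<xi>)"
  using f measurable_cosine_gradient
  by (rule Bochner_Integration.integrable_bound) (use cosine_gradient_bound in simp)

text \<open>For almost every \<open>\<xi>\<close> the integrand is constant in \<open>y\<close> near
  \<open>x\<close>, so pointwise convergence is immediate and the bound
  \<open>\<bar>f \<xi>\<bar>\<close> suffices.\<close>

lemma isCont_cosine_gradient:
  assumes "x \<noteq> 0"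
  shows "isCont (cosine_gradient f) x"
  unfolding isCont_def cosine_gradient_def
proof (rule tendsto_integral_at[where w = "\<lambda>\<xi>. \<bar>f \<xi>\<bar>"])
  show "AE \<xi> in sphere_lebesgue.
      ((\<lambda>y. (sgn (y \<bullet> \<xi>) * f \<xi>) *\<^sub>R \<xi>) \<longlongrightarrow> (sgn (x \<bullet> \<xi>) * f \<xi>) *\<^sub>R \<xi>) (at x)"
    using AE_sphere_lebesgue_inner_nonzero[OF assms]
    by eventually_elim
      (rule tendsto_eventually, auto elim: eventually_mono dest!: eventually_sgn_inner_eq)
qed (use f measurable_cosine_gradient cosine_gradient_bound in auto)

lemma has_derivative_cosine_transform:
  assumes "x \<noteq> 0"
  shows "(cosine_transform f has_derivative (\<lambda>h. cosine_gradient f x \<bullet> h)) (at x)"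
proof -
  \<comment> \<open>First-order remainder at \<open>x\<close> of the integrand, divided by the
    increment. Division by zero gives 0 at \<open>y = x\<close>, so the bound below holds for every
    \<open>y\<close>.\<close>
  define r where "r y \<xi> = (\<bar>y \<bullet> \<xi>\<bar> - \<bar>x \<bullet> \<xi>\<bar> - sgn (x \<bullet> \<xi>) * ((y - x) \<bullet> \<xi>)) * f \<xi> / norm (y - x)"
    for y \<xi>
  have "((\<lambda>y. \<integral>\<xi>. r y \<xi> \<partial>sphere_lebesgue) \<longlongrightarrow> (\<integral>\<xi>. 0 \<partial>(sphere_lebesgue :: 'a measure))) (at x)"
  proof (rule tendsto_integral_at[where w = "\<lambda>\<xi>. 2 * \<bar>f \<xi>\<bar>"])
    show "r y \<in> borel_measurable sphere_lebesgue" for y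
      unfolding r_def
      by (intro borel_measurable_times borel_measurable_divide borel_measurable_const
          borel_measurable_sphere_lebesgue borel_measurable_integrable[OF f]) measurable
    \<comment> \<open>Where the signs agree, both absolute values are given by the same linear
      function, so the remainder vanishes exactly.\<close>
    have r_eq_0: "r y \<xi> = 0" if "sgn (y \<bullet> \<xi>) = sgn (x \<bullet> \<xi>)" for y \<xi>
    proof -
      have "\<bar>y \<bullet> \<xi>\<bar> = sgn (x \<bullet> \<xi>) * (y \<bullet> \<xi>)" "\<bar>x \<bullet> \<xi>\<bar> = sgn (x \<bullet> \<xi>) * (x \<bullet> \<xi>)"
        using that by (metis abs_sgn mult.commute)+
      then show ?thesis
        by (simp add: r_def inner_diff_left algebra_simps)
    qed
    show "AE \<xi> in sphere_lebesgue. ((\<lambda>y. r y \<xi>) \<longlongrightarrow> 0) (at x)"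
      using AE_sphere_lebesgue_inner_nonzero[OF assms]
      by eventually_elim
        (rule tendsto_eventually, rule eventually_mono[OF eventually_sgn_inner_eq r_eq_0])
    have "norm (r y \<xi>) \<le> 2 * \<bar>f \<xi>\<bar>" if "norm \<xi> = 1" for y \<xi>
    proof (cases "y = x")
      case False
      have "\<bar>(y - x) \<bullet> \<xi>\<bar> \<le> norm (y - x)"
        using Cauchy_Schwarz_ineq2[of "y - x" \<xi>] that by simp
      \<comment> \<open>The factor 2 collects one \<open>norm (y - x)\<close> from the reverse
        triangle inequality and one from the linear term.\<close>
      then have "\<bar>\<bar>y \<bullet> \<xi>\<bar> - \<bar>x \<bullet> \<xi>\<bar> - sgn (x \<bullet> \<xi>) * ((y - x) \<bullet> \<xi>)\<bar> \<le> 2 * norm (y - x)"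
        by (auto simp: inner_diff_left sgn_if)
      then have "\<bar>\<bar>y \<bullet> \<xi>\<bar> - \<bar>x \<bullet> \<xi>\<bar> - sgn (x \<bullet> \<xi>) * ((y - x) \<bullet> \<xi>)\<bar> * \<bar>f \<xi>\<bar>
          \<le> 2 * norm (y - x) * \<bar>f \<xi>\<bar>"
        by (rule mult_right_mono) simp
      with False show ?thesis
        by (simp add: r_def abs_mult divide_le_eq mult_ac)
    qed (simp add: r_def)
    then show "AE \<xi> in sphere_lebesgue. norm (r y \<xi>) \<le> 2 * \<bar>f \<xi>\<bar>" for y
      by (rule AE_sphere_lebesgueI)
  qed (use f in auto)
  \<comment> \<open>Integrability of the three terms lets the integral split, which identifies it
    with the difference quotient for the derivative.\<close>
  moreover have "(\<integral>\<xi>. r y \<xi> \<partial>sphere_lebesgue)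
      = (cosine_transform f y - cosine_transform f x - cosine_gradient f x \<bullet> (y - x)) / norm (y - x)"
    for y
  proof -
    have "cosine_gradient f x \<bullet> (y - x)
        = (\<integral>\<xi>. ((sgn (x \<bullet> \<xi>) * f \<xi>) *\<^sub>R \<xi>) \<bullet> (y - x) \<partial>sphere_lebesgue)"
      unfolding cosine_gradient_def
      by (rule integral_inner_left[symmetric]) (rule integrable_cosine_gradient)
    moreover have "integrable sphere_lebesgue (\<lambda>\<xi>. ((sgn (x \<bullet> \<xi>) * f \<xi>) *\<^sub>R \<xi>) \<bullet> (y - x))"
      by (intro integrable_inner_left integrable_cosine_gradient)
    moreover have "r y = (\<lambda>\<xi>. (\<bar>y \<bullet> \<xi>\<bar> * f \<xi> - \<bar>x \<bullet> \<xi>\<bar> * f \<xi>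
        - ((sgn (x \<bullet> \<xi>) * f \<xi>) *\<^sub>R \<xi>) \<bullet> (y - x)) / norm (y - x))"
      by (rule ext) (simp add: r_def inner_commute algebra_simps)
    ultimately show ?thesis
      \<comment> \<open>Without \<open>inner_scaleR_left\<close> the inner products keep the form in
        which the preceding facts state them.\<close>
      by (simp add: cosine_transform_def integrable_cosine_transform del: inner_scaleR_left)
  qed
  ultimately have "((\<lambda>y. (cosine_transform f y - cosine_transform f x
      - cosine_gradient f x \<bullet> (y - x)) / norm (y - x)) \<longlongrightarrow> 0) (at x)"
    by simp
  from tendsto_norm_zero[OF this] show ?thesis
    by (simp add: has_derivative_iff_norm bounded_linear_inner_right)
qed

end

theorem proposition2p3:
  fixes f :: "real ^ 'n \<Rightarrow> real"
  assumes "CARD('n) \<ge> 2"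
    and "integrable sphere_lebesgue f"
  shows "continuously_differentiable_on (cosine_transform f) (UNIV - {0})"
  unfolding continuously_differentiable_on_def
proof (intro conjI exI ballI)
  show "(cosine_transform f has_derivative
      blinfun_apply (blinfun_inner_right (cosine_gradient f x))) (at x)"
    if "x \<in> UNIV - {0}" for x
    using has_derivative_cosine_transform[OF assms(2)] that by simp
  \<comment> \<open>Passing from a vector to the functional it represents is bounded linear, so
    continuity of the gradient gives continuity in operator norm.\<close>
  show "continuous_on (UNIV - {0}) (\<lambda>x. blinfun_inner_right (cosine_gradient f x))"
    using isCont_cosine_gradient[OF assms(2)]
    by (intro bounded_linear.continuous_on[OF bounded_linear_blinfun_inner_right]
        continuous_at_imp_continuous_on) simp
qed (simp add: open_delete)

end
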